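(* Suppose $\nabla f_t(x_t^* )=0$ for every $t\in\mathbb{Z}_{\ge0}$, and suppose there are $\mu>0$, $L>0$ and $L_1,\ldots,L_P>0$ such that for all $t\in\mathbb{Z}_{\ge0}$, $x,y\in\mathbb{R}^n$, $1\le i\le P$ and $u\in\mathbb{R}^{n_i}$, $$f_t(y)\ge f_t(x)+\nabla f_t(x)^T(y-x)+\frac{\mu}{2}|y-x|^2,\quad |\nabla f_t(x)-\nabla f_t(y)|\le L|x-y|,\quad |\nabla_{(i)}f_t(x+H_iu)-\nabla_{(i)}f_t(x)|\le L_i|u| .$$ Let $L_{\max}=\max\{L_1,\ldots,L_P\}$, and let the stepsize be a constant $\alpha_t=\alpha<\frac{2}{L_{\max}}$. Put $\bar A=\frac1P\big(\alpha-\frac{\alpha^2L_{\max}}{2}\big)$ and let $k\ge1$ be an integer such that $$B_6:=\frac{L}{\mu}(1-2\mu\bar A)^{\frac{k+1-P}{P}}(1+\alpha L_{\max})^{2P-2}<\frac12 .$$ Then the dynamic regret of the $k$-step online coordinate descent algorithm with Gauss-Southwell rule satisfies $$R_T^d\le\frac{L}{2-4B_6}(2C_{T,2}+C_2),$$ where $C_{T,2}=\sum_{t=1}^T|x_t^*-x_{t-1}^*|^2$ and $C_2=|x_1-x_1^*|^2-2|x_1^*-x_0^*|^2$.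
   Context: For each $t\in\mathbb{Z}_{\ge0}$, $f_t:\mathbb{R}^n\to\mathbb{R}$ is convex and continuously differentiable; $\Theta\subseteq\mathbb{R}^n$ is a non-empty closed convex set with Euclidean projection $\Pi_\Theta$; $|\cdot|$ is the Euclidean norm. The decision variable is partitioned into $P$ blocks, $x=(x_{(1)},\ldots,x_{(P)})$, $x_{(p)}\in\mathbb{R}^{n_p}$, $\sum_{p=1}^P n_p=n$; $\nabla_{(p)}f_t$ denotes the $p$-th block of the gradient, and $H_i\in\mathbb{R}^{n\times n_i}$ are the matrices with $[H_1\ H_2\cdots H_P]=I_n$. $k$-step online coordinate descent algorithm with Gauss-Southwell rule: start from $x_0\in\Theta$ and an integer $k\ge1$. At each time $t$ set $\hat x_0=x_t$ and perform $k$ block updates with the function $f_t$: for $\kappa=1,\ldots,k$, choose $i_\kappa\in\arg\max_i|\nabla_{(i)}f_t(\hat x_{\kappa-1})|$ and set $\hat x_{(i_\kappa),\kappa}=\hat x_{(i_\kappa),\kappa-1}-\alpha_t\nabla_{(i_\kappa)}f_t(\hat x_{\kappa-1})$, $\hat x_{(i),\kappa}=\hat x_{(i),\kappa-1}$ for $i\ne i_\kappa$. Then $x_{t+1}=\Pi_\Theta(\hat x_k)$. Stepsizes are positive. $x_t^*\in\Theta$ denotes the minimizer of $f_t$ over $\Theta$. The dynamic regret (the algorithm being deterministic) is $R_T^d=\sum_{t=1}^Tf_t(x_t)-\sum_{t=1}^Tf_t(x_t^* )$. *)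

theory Defs
  imports "HOL-Analysis.Analysis"
begin

text \<open>
  A block decomposition of \<open>real ^ 'n\<close> into \<open>CARD('p)\<close> blocks is given by the map
  \<open>blk :: 'n \<Rightarrow> 'p\<close> that sends each coordinate to the block it belongs to. The space
  of the \<open>p\<close>-th block is identified with its image under the coordinate embedding
  \<open>H\<^sub>p\<close>, i.e. with the vectors that vanish outside block \<open>p\<close>; this embedding is
  isometric, so norms of blocks are norms in \<open>real ^ 'n\<close>.
\<close>

definition block_space :: "('n::finite \<Rightarrow> 'p) \<Rightarrow> 'p \<Rightarrow> (real ^ 'n) set" where
  "block_space blk p = {u. \<forall>j. blk j \<noteq> p \<longrightarrow> u $ j = 0}"

definition block :: "('n::finite \<Rightarrow> 'p) \<Rightarrow> 'p \<Rightarrow> real ^ 'n \<Rightarrow> real ^ 'n" where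
  "block blk p v = (\<chi> j. if blk j = p then v $ j else 0)"

text \<open>One block update, with gradient \<open>g\<close> and stepsize \<open>a\<close>. The block of largest gradient
  need not be unique; any maximizer may be chosen.\<close>

definition gauss_southwell_update ::
  "('n::finite \<Rightarrow> 'p) \<Rightarrow> (real ^ 'n \<Rightarrow> real ^ 'n) \<Rightarrow> real \<Rightarrow> real ^ 'n \<Rightarrow> real ^ 'n \<Rightarrow> bool" where
  "gauss_southwell_update blk g a y y' \<longleftrightarrow>
     (\<exists>i. is_arg_max (\<lambda>p. norm (block blk p (g y))) (\<lambda>_. True) i \<and>
          block blk i y' = block blk i y - a *\<^sub>R block blk i (g y) \<and>
          (\<forall>p. p \<noteq> i \<longrightarrow> block blk p y' = block blk p y))"

text \<open>\<open>x\<close> is a sequence of iterates produced by the \<open>k\<close>-step online algorithm, where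
  \<open>G t\<close> is the gradient of the cost at time \<open>t\<close>.\<close>

definition online_cd_gauss_southwell ::
  "(real ^ 'n::finite) set \<Rightarrow> ('n \<Rightarrow> 'p) \<Rightarrow> (nat \<Rightarrow> real ^ 'n \<Rightarrow> real ^ 'n) \<Rightarrow> (nat \<Rightarrow> real)
     \<Rightarrow> nat \<Rightarrow> (nat \<Rightarrow> real ^ 'n) \<Rightarrow> bool" where
  "online_cd_gauss_southwell \<Theta> blk G \<alpha> k x \<longleftrightarrow>
     x 0 \<in> \<Theta> \<and>
     (\<forall>t. \<exists>xh :: nat \<Rightarrow> real ^ 'n.
        xh 0 = x t \<and>
        (\<forall>\<kappa><k. gauss_southwell_update blk (G t) (\<alpha> t) (xh \<kappa>) (xh (Suc \<kappa>))) \<and>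
        x (Suc t) = closest_point \<Theta> (xh k))"

definition dynamic_regret :: "(nat \<Rightarrow> 'a \<Rightarrow> real) \<Rightarrow> (nat \<Rightarrow> 'a) \<Rightarrow> (nat \<Rightarrow> 'a) \<Rightarrow> nat \<Rightarrow> real" where
  "dynamic_regret f x xs T = (\<Sum>t=1..T. f t (x t)) - (\<Sum>t=1..T. f t (xs t))"

end

theory Submission
  imports Defs
begin

text \<open>
  Write \<open>d\<^sub>t = |x\<^sub>t - x\<^sub>t\<^sup>*|\<^sup>2\<close>, and let \<open>P\<close> be the number of blocks and
  \<open>q = 1 - 2 \<mu> Abar\<close>. The blocks of a gradient are orthogonal, so the largest one carries at
  least the fraction \<open>1/P\<close> of its squared norm. Hence a Gauss-Southwell update decreases
  the cost by at least \<open>Abar\<close> times the squared norm of the \<^emph>\<open>full\<close> gradient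
  (\<open>gauss_southwell_decrease\<close>), so it is as good as a full gradient step of smaller size.
  Strong convexity bounds that squared norm below by \<open>2 \<mu>\<close> times the gap to the minimal
  cost (\<open>strongly_convex_PL\<close>), so every update contracts the gap by the factor \<open>q\<close>. As the
  gap is squeezed between \<open>\<mu>/2\<close> and \<open>L/2\<close> times the squared distance to the minimizer and
  the projection onto \<open>\<Theta>\<close> is nonexpansive, \<open>k\<close> updates yield
  \<open>|x\<^sub>t\<^sub>+\<^sub>1 - x\<^sub>t\<^sup>*|\<^sup>2 \<le> (L / \<mu>) q\<^sup>k d\<^sub>t\<close>.

  This rate is at least as good as \<open>B6\<close>: we have \<open>0 \<le> q < 1\<close> and \<open>k \<ge> (k + 1 - P) / P\<close>, and
  the factor \<open>(1 + \<alpha> Lmax) ^ (2 P - 2)\<close> is at least 1. Therefore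
  \<open>d\<^sub>t\<^sub>+\<^sub>1 \<le> 2 B6 d\<^sub>t + 2 |x\<^sub>t\<^sub>+\<^sub>1\<^sup>* - x\<^sub>t\<^sup>*|\<^sup>2\<close>. As \<open>2 B6 < 1\<close>, summing this recursion bounds
  the sum of the \<open>d\<^sub>t\<close> (\<open>sum_le_of_contraction\<close>), and the regret is at most \<open>L/2\<close> times
  that sum.
\<close>

section \<open>Orthogonal decomposition into blocks\<close>

lemma block_in_block_space: "block blk p v \<in> block_space blk p"
  by (simp add: block_def block_space_def)

lemma inner_block: "v \<bullet> block blk p w = block blk p v \<bullet> block blk p w"
  unfolding inner_vec_def block_def by (intro sum.cong) auto

lemma block_of_block_space: "u \<in> block_space blk p \<Longrightarrow> block blk p u = u"
  by (auto simp: block_def block_space_def vec_eq_iff)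

lemma inner_block_space:
  assumes "u \<in> block_space blk p"
  shows "v \<bullet> u = block blk p v \<bullet> u"
  using inner_block[of v blk p u] block_of_block_space[OF assms] by simp

lemma block_diff: "block blk p (v - w) = block blk p v - block blk p w"
  by (simp add: block_def vec_eq_iff)

lemma block_scaleR: "block blk p (c *\<^sub>R v) = c *\<^sub>R block blk p v"
  by (simp add: block_def vec_eq_iff)

lemma scaleR_block_space: "u \<in> block_space blk p \<Longrightarrow> c *\<^sub>R u \<in> block_space blk p"
  by (simp add: block_space_def)

lemma vec_eq_iff_block: "v = w \<longleftrightarrow> (\<forall>p. block blk p v = block blk p w)"
proof
  assume eq: "\<forall>p. block blk p v = block blk p w"
  have "v $ j = w $ j" for j
    using arg_cong[OF spec[OF eq, of "blk j"], of "\<lambda>u. u $ j"] by (simp add: block_def)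
  then show "v = w" by (simp add: vec_eq_iff)
qed simp

lemma block_block: "block blk p (block blk i v) = (if p = i then block blk i v else 0)"
  by (auto simp: block_def vec_eq_iff)

lemma sum_norm_block:
  fixes blk :: "'n::finite \<Rightarrow> 'p::finite"
  shows "(\<Sum>p\<in>UNIV. (norm (block blk p v))\<^sup>2) = (norm v)\<^sup>2"
proof -
  have "(norm (block blk p v))\<^sup>2 = (\<Sum>j\<in>UNIV. if blk j = p then (v $ j)\<^sup>2 else 0)" for p
    unfolding power2_norm_eq_inner inner_vec_def block_def
    by (intro sum.cong) (auto simp: power2_eq_square)
  then have "(\<Sum>p\<in>UNIV. (norm (block blk p v))\<^sup>2)
      = (\<Sum>p\<in>UNIV. \<Sum>j\<in>UNIV. if blk j = p then (v $ j)\<^sup>2 else 0)" by simp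
  also have "\<dots> = (\<Sum>j\<in>UNIV. \<Sum>p\<in>UNIV. if blk j = p then (v $ j)\<^sup>2 else 0)"
    by (rule sum.swap)
  also have "\<dots> = (norm v)\<^sup>2"
    unfolding power2_norm_eq_inner inner_vec_def by (simp add: power2_eq_square)
  finally show ?thesis .
qed

text \<open>A maximum is at least the average; here the factor \<open>1/P\<close> in the contraction rate originates.\<close>

lemma norm_le_max_block:
  fixes blk :: "'n::finite \<Rightarrow> 'p::finite"
  assumes "is_arg_max (\<lambda>p. norm (block blk p v)) (\<lambda>_. True) i"
  shows "(norm v)\<^sup>2 \<le> real CARD('p) * (norm (block blk i v))\<^sup>2"
proof -
  have "norm (block blk p v) \<le> norm (block blk i v)" for p
    using assms by (simp add: is_arg_max_linorder)
  then have "(\<Sum>p\<in>UNIV. (norm (block blk p v))\<^sup>2) \<le> (\<Sum>p\<in>(UNIV :: 'p set). (norm (block blk i v))\<^sup>2)"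
    by (intro sum_mono power_mono) auto
  then show ?thesis by (simp add: sum_norm_block)
qed

lemma ex_max_block:
  fixes blk :: "'n::finite \<Rightarrow> 'p::finite"
  shows "\<exists>i. is_arg_max (\<lambda>p. norm (block blk p v)) (\<lambda>_. True) i"
proof -
  let ?N = "range (\<lambda>p. norm (block blk p v))"
  have "Max ?N \<in> ?N" by (intro Max_in) auto
  then obtain i where "Max ?N = norm (block blk i v)" by blast
  moreover have "norm (block blk p v) \<le> Max ?N" for p by (intro Max_ge) auto
  ultimately show ?thesis by (auto simp: is_arg_max_linorder)
qed

lemma gauss_southwell_update_iff:
  "gauss_southwell_update blk g a y y' \<longleftrightarrow>
     (\<exists>i. is_arg_max (\<lambda>p. norm (block blk p (g y))) (\<lambda>_. True) i \<and>
          y' = y - a *\<^sub>R block blk i (g y))"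
proof -
  have "y' = y - a *\<^sub>R block blk i (g y) \<longleftrightarrow>
      block blk i y' = block blk i y - a *\<^sub>R block blk i (g y) \<and>
      (\<forall>p. p \<noteq> i \<longrightarrow> block blk p y' = block blk p y)" for i
    unfolding vec_eq_iff_block[of y' _ blk] by (auto simp: block_diff block_scaleR block_block)
  then show ?thesis by (simp add: gauss_southwell_update_def)
qed

section \<open>Smooth and strongly convex functions\<close>

text \<open>
  The hypothesis restricts the growth of the gradient only along the segment from \<open>z\<close> to
  \<open>z + u\<close>, so that the bound serves both for the global Lipschitz constant and for the
  constant of a single block.
\<close>

lemma descent_lemma:
  fixes f :: "'a::real_inner \<Rightarrow> real"
  assumes deriv: "\<And>z. GDERIV f z :> G z"
    and growth: "\<And>s. 0 \<le> s \<Longrightarrow> s \<le> 1 \<Longrightarrow> (G (z + s *\<^sub>R u) - G z) \<bullet> u \<le> M * s * (norm u)\<^sup>2"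
  shows "f (z + u) \<le> f z + G z \<bullet> u + M / 2 * (norm u)\<^sup>2"
proof -
  define \<phi> where "\<phi> s = f (z + s *\<^sub>R u) - s * (G z \<bullet> u) - M / 2 * s\<^sup>2 * (norm u)\<^sup>2" for s
  have D: "((\<lambda>s. f (z + s *\<^sub>R u)) has_real_derivative G (z + s *\<^sub>R u) \<bullet> u) (at s)" for s
  proof -
    have "(f has_derivative (\<lambda>h. h \<bullet> G (z + s *\<^sub>R u))) (at (z + s *\<^sub>R u))"
      using deriv[of "z + s *\<^sub>R u"] unfolding gderiv_def .
    moreover have "((\<lambda>s. z + s *\<^sub>R u) has_derivative (\<lambda>h. h *\<^sub>R u)) (at s)"
      by (auto intro!: derivative_eq_intros)
    ultimately have "((\<lambda>s. f (z + s *\<^sub>R u)) has_derivative (\<lambda>h. (h *\<^sub>R u) \<bullet> G (z + s *\<^sub>R u))) (at s)"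
      by (rule has_derivative_compose[rotated])
    then show ?thesis
      by (simp add: has_field_derivative_def inner_commute mult_commute_abs)
  qed
  have "\<phi> 1 \<le> \<phi> 0"
  proof (rule DERIV_nonpos_imp_nonincreasing[of 0 1 \<phi>])
    fix s :: real assume s: "0 \<le> s" "s \<le> 1"
    have "(\<phi> has_real_derivative G (z + s *\<^sub>R u) \<bullet> u - G z \<bullet> u - M * s * (norm u)\<^sup>2) (at s)"
      unfolding \<phi>_def by (auto intro!: derivative_eq_intros D)
    with growth[OF s] show "\<exists>y. DERIV \<phi> s :> y \<and> y \<le> 0"
      by (intro exI conjI) (auto simp: inner_diff_left)
  qed simp
  then show ?thesis by (simp add: \<phi>_def)
qed

lemma lipschitz_gradient_upper_bound:
  fixes f :: "'a::real_inner \<Rightarrow> real"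
  assumes deriv: "\<And>z. GDERIV f z :> G z"
    and lip: "\<And>z y. norm (G z - G y) \<le> L * norm (z - y)"
  shows "f (z + u) \<le> f z + G z \<bullet> u + L / 2 * (norm u)\<^sup>2"
proof (rule descent_lemma[where G = G and M = L, OF deriv])
  fix s :: real assume s: "0 \<le> s"
  have "(G (z + s *\<^sub>R u) - G z) \<bullet> u \<le> norm (G (z + s *\<^sub>R u) - G z) * norm u"
    by (rule norm_cauchy_schwarz)
  also have "\<dots> \<le> (L * (s * norm u)) * norm u"
    using lip[of "z + s *\<^sub>R u" z] s by (intro mult_right_mono) auto
  finally show "(G (z + s *\<^sub>R u) - G z) \<bullet> u \<le> L * s * (norm u)\<^sup>2"
    by (simp add: power2_eq_square mult.assoc)
qed

lemma block_lipschitz_gradient_upper_bound: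
  fixes f :: "real ^ 'n::finite \<Rightarrow> real"
  assumes deriv: "\<And>z. GDERIV f z :> G z"
    and lip: "\<And>z u. u \<in> block_space blk p \<Longrightarrow>
           norm (block blk p (G (z + u)) - block blk p (G z)) \<le> M * norm u"
    and u: "u \<in> block_space blk p"
  shows "f (z + u) \<le> f z + G z \<bullet> u + M / 2 * (norm u)\<^sup>2"
proof (rule descent_lemma[where G = G and M = M, OF deriv])
  fix s :: real assume s: "0 \<le> s"
  have "(G (z + s *\<^sub>R u) - G z) \<bullet> u = (block blk p (G (z + s *\<^sub>R u)) - block blk p (G z)) \<bullet> u"
    using inner_block_space[OF u, of "G (z + s *\<^sub>R u) - G z"] by (simp add: block_diff)
  also have "\<dots> \<le> norm (block blk p (G (z + s *\<^sub>R u)) - block blk p (G z)) * norm u"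
    by (rule norm_cauchy_schwarz)
  also have "\<dots> \<le> (M * (s * norm u)) * norm u"
    using lip[OF scaleR_block_space[OF u], of z s] s by (intro mult_right_mono) auto
  finally show "(G (z + s *\<^sub>R u) - G z) \<bullet> u \<le> M * s * (norm u)\<^sup>2"
    by (simp add: power2_eq_square mult.assoc)
qed

text \<open>
  Minimizing the quadratic minorant at \<open>z\<close> over all of space bounds \<open>f\<close> below in terms of the
  gradient at \<open>z\<close>; this is the Polyak-Lojasiewicz inequality.
\<close>

lemma strongly_convex_PL:
  fixes f :: "'a::real_inner \<Rightarrow> real"
  assumes "\<mu> > 0"
    and sc: "f y \<ge> f z + g \<bullet> (y - z) + \<mu> / 2 * (norm (y - z))\<^sup>2"
  shows "2 * \<mu> * (f z - f y) \<le> (norm g)\<^sup>2"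
proof -
  have "0 \<le> (norm (g + \<mu> *\<^sub>R (y - z)))\<^sup>2" by simp
  also have "\<dots> = (norm g)\<^sup>2 + 2 * \<mu> * (g \<bullet> (y - z) + \<mu> / 2 * (norm (y - z))\<^sup>2)"
    unfolding power2_norm_eq_inner inner_add_left inner_add_right inner_scaleR_left
      inner_scaleR_right inner_commute[of "y - z" g]
    by (simp add: algebra_simps)
  also have "\<dots> \<le> (norm g)\<^sup>2 + 2 * \<mu> * (f y - f z)"
    using sc \<open>\<mu> > 0\<close> by (intro add_left_mono mult_left_mono) auto
  finally show ?thesis by (simp add: algebra_simps)
qed

section \<open>Contraction by Gauss-Southwell updates\<close>

text \<open>
  A single constant \<open>M\<close> serves all blocks because the maximal block is not known in advance.
  The condition on \<open>\<alpha>\<close> makes the decrease along any block nonnegative.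
\<close>

locale block_smooth_strongly_convex =
  fixes f :: "real ^ 'n::finite \<Rightarrow> real" and G :: "real ^ 'n \<Rightarrow> real ^ 'n"
    and blk :: "'n \<Rightarrow> 'p::finite" and \<mu> M \<alpha> :: real
  assumes deriv: "\<And>z. GDERIV f z :> G z"
    and strongly_convex: "\<And>z y. f y \<ge> f z + G z \<bullet> (y - z) + \<mu> / 2 * (norm (y - z))\<^sup>2"
    and modulus_pos: "\<mu> > 0"
    and block_lipschitz: "\<And>z p u. u \<in> block_space blk p \<Longrightarrow>
           norm (block blk p (G (z + u)) - block blk p (G z)) \<le> M * norm u"
    and stepsize: "0 \<le> \<alpha> - \<alpha>\<^sup>2 * M / 2"
begin

text \<open>The decrease of \<open>f\<close> guaranteed by one update per unit of squared gradient norm.\<close>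

definition gain :: real where
  "gain = 1 / real CARD('p) * (\<alpha> - \<alpha>\<^sup>2 * M / 2)"

lemma gain_nonneg: "0 \<le> gain"
  using stepsize by (simp add: gain_def)

lemma critical_lower_bound: "G w = 0 \<Longrightarrow> f w + \<mu> / 2 * (norm (y - w))\<^sup>2 \<le> f y"
  using strongly_convex[of w y] by simp

text \<open>
  Moving in the single direction of block \<open>i\<close> costs at most the curvature of that block,
  and the decrease is governed by the largest block, hence by the full gradient.
\<close>

lemma gauss_southwell_decrease:
  assumes upd: "gauss_southwell_update blk G \<alpha> y y'"
  shows "f y' \<le> f y - gain * (norm (G y))\<^sup>2"
proof -
  obtain i where i: "is_arg_max (\<lambda>p. norm (block blk p (G y))) (\<lambda>_. True) i"
    and y': "y' = y - \<alpha> *\<^sub>R block blk i (G y)"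
    using upd by (auto simp: gauss_southwell_update_iff)
  define c b where "c = \<alpha> - \<alpha>\<^sup>2 * M / 2" and "b = block blk i (G y)"
  have b: "(- \<alpha>) *\<^sub>R b \<in> block_space blk i"
    unfolding b_def by (intro scaleR_block_space block_in_block_space)
  have "f y' \<le> f y + G y \<bullet> ((- \<alpha>) *\<^sub>R b) + M / 2 * (norm ((- \<alpha>) *\<^sub>R b))\<^sup>2"
    using block_lipschitz_gradient_upper_bound[of f G blk i M, OF deriv block_lipschitz b, of y]
    by (simp add: y' b_def)
  also have "G y \<bullet> ((- \<alpha>) *\<^sub>R b) = - \<alpha> * (norm b)\<^sup>2"
    using inner_block[of "G y" blk i "G y"] by (simp add: b_def power2_norm_eq_inner)
  also have "(norm ((- \<alpha>) *\<^sub>R b))\<^sup>2 = \<alpha>\<^sup>2 * (norm b)\<^sup>2"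
    by (simp add: power_mult_distrib)
  also have "f y + - \<alpha> * (norm b)\<^sup>2 + M / 2 * (\<alpha>\<^sup>2 * (norm b)\<^sup>2) = f y - c * (norm b)\<^sup>2"
    by (simp add: c_def algebra_simps)
  also have "\<dots> \<le> f y - c * ((norm (G y))\<^sup>2 / real CARD('p))"
    using norm_le_max_block[OF i] stepsize
    by (intro diff_left_mono mult_left_mono) (auto simp: b_def c_def field_simps)
  finally show ?thesis by (simp add: c_def gain_def)
qed

lemma gauss_southwell_contraction:
  assumes upd: "gauss_southwell_update blk G \<alpha> y y'"
  shows "f y' - f w \<le> (1 - 2 * \<mu> * gain) * (f y - f w)"
proof -
  have PL: "2 * \<mu> * (f y - f w) \<le> (norm (G y))\<^sup>2"
    by (rule strongly_convex_PL[OF modulus_pos strongly_convex])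
  have "f y' \<le> f y - gain * (norm (G y))\<^sup>2"
    by (rule gauss_southwell_decrease[OF upd])
  also have "\<dots> \<le> f y - gain * (2 * \<mu> * (f y - f w))"
    by (intro diff_left_mono mult_left_mono PL gain_nonneg)
  finally show ?thesis by (simp add: algebra_simps)
qed

text \<open>
  The factor cannot be negative: a single update from any point other than the minimizer
  would otherwise reach a value below the minimum.
\<close>

lemma contraction_factor_nonneg:
  assumes crit: "G w = 0"
  shows "0 \<le> 1 - 2 * \<mu> * gain"
proof -
  define y where "y = w + axis undefined 1"
  obtain i where "is_arg_max (\<lambda>p. norm (block blk p (G y))) (\<lambda>_. True) i"
    using ex_max_block[of blk "G y"] by blast
  then obtain y' where "gauss_southwell_update blk G \<alpha> y y'"
    by (auto simp: gauss_southwell_update_iff)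
  then have "f y' - f w \<le> (1 - 2 * \<mu> * gain) * (f y - f w)"
    by (rule gauss_southwell_contraction)
  moreover have "0 \<le> \<mu> / 2 * (norm (y' - w))\<^sup>2"
    using modulus_pos by simp
  then have "f w \<le> f y'"
    using critical_lower_bound[OF crit, of y'] by linarith
  ultimately have "0 \<le> (1 - 2 * \<mu> * gain) * (f y - f w)" by linarith
  moreover have "norm (y - w) = 1" by (simp add: y_def norm_axis_1)
  then have "0 < f y - f w"
    using critical_lower_bound[OF crit, of y] modulus_pos by simp
  ultimately show ?thesis by (simp add: zero_le_mult_iff)
qed

text \<open>
  Function values contract at every update although distances need not; the quadratic bounds
  translate between the two at the first and the last point only, so the condition number
  \<open>L / \<mu>\<close> enters once and is not raised to the power \<open>k\<close>.
\<close>

lemma gauss_southwell_steps_dist: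
  assumes crit: "G w = 0"
    and lip: "\<And>z y. norm (G z - G y) \<le> L * norm (z - y)"
    and upd: "\<And>\<kappa>. \<kappa> < k \<Longrightarrow> gauss_southwell_update blk G \<alpha> (xh \<kappa>) (xh (Suc \<kappa>))"
  shows "(norm (xh k - w))\<^sup>2 \<le> L / \<mu> * (1 - 2 * \<mu> * gain) ^ k * (norm (xh 0 - w))\<^sup>2"
proof -
  define q where "q = 1 - 2 * \<mu> * gain"
  have q: "0 \<le> q"
    unfolding q_def by (rule contraction_factor_nonneg[OF crit])
  have "\<kappa> \<le> k \<Longrightarrow> f (xh \<kappa>) - f w \<le> q ^ \<kappa> * (f (xh 0) - f w)" for \<kappa>
  proof (induction \<kappa>)
    case (Suc \<kappa>)
    then have "f (xh (Suc \<kappa>)) - f w \<le> q * (f (xh \<kappa>) - f w)"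
      unfolding q_def by (intro gauss_southwell_contraction upd) auto
    also have "\<dots> \<le> q * (q ^ \<kappa> * (f (xh 0) - f w))"
      using Suc q by (intro mult_left_mono) auto
    finally show ?case by (simp add: mult.assoc)
  qed simp
  then have "f (xh k) - f w \<le> q ^ k * (f (xh 0) - f w)" by simp
  also have "f (xh 0) - f w \<le> L / 2 * (norm (xh 0 - w))\<^sup>2"
    using lipschitz_gradient_upper_bound[of f G L, OF deriv lip, of w "xh 0 - w"]
    by (simp add: crit)
  then have "q ^ k * (f (xh 0) - f w) \<le> q ^ k * (L / 2 * (norm (xh 0 - w))\<^sup>2)"
    using q by (intro mult_left_mono) auto
  finally have "\<mu> / 2 * (norm (xh k - w))\<^sup>2 \<le> q ^ k * (L / 2 * (norm (xh 0 - w))\<^sup>2)"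
    using critical_lower_bound[OF crit, of "xh k"] by linarith
  then show ?thesis using modulus_pos unfolding q_def[symmetric] by (simp add: field_simps)
qed

end

section \<open>Regret\<close>

text \<open>
  In the application, \<open>d t\<close> is the squared tracking error and \<open>e t\<close> twice the squared drift of
  the minimizer. Summing the recursion from \<open>t = 2\<close> bounds the sum of the \<open>d t\<close> by \<open>b\<close> times
  itself plus the drift, and the former term is moved to the left. The first summand obeys no
  recursion within the range; it accounts for the correction \<open>d 1 - e 1\<close>.
\<close>

lemma sum_le_of_contraction:
  fixes d e :: "nat \<Rightarrow> real"
  assumes rec: "\<And>t. d (Suc t) \<le> b * d t + e (Suc t)"
    and "\<And>t. 0 \<le> d t" and "0 \<le> b" and "T \<ge> 1"
  shows "(1 - b) * (\<Sum>t=1..T. d t) \<le> (\<Sum>t=1..T. e t) + d 1 - e 1"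
proof -
  \<comment> \<open>The term \<open>b * d T\<close> is what the recursion consumes in the next step of the induction.\<close>
  have "(\<Sum>t=1..T. d t) + b * d T \<le> b * (\<Sum>t=1..T. d t) + (\<Sum>t=1..T. e t) + d 1 - e 1"
    using \<open>T \<ge> 1\<close>
  proof (induction T rule: dec_induct)
    case (step T)
    then show ?case using rec[of T] by (simp add: algebra_simps)
  qed simp
  moreover have "0 \<le> b * d T" using assms by simp
  ultimately show ?thesis by (simp add: algebra_simps)
qed

text \<open>For \<open>0 < q \<le> 1\<close> this is monotonicity in the exponent. For \<open>q = 0\<close> both sides vanish:
  the left one since \<open>k \<ge> 1\<close>, the right one by the convention \<open>0 powr e = 0\<close>.\<close>

lemma power_le_powr:
  fixes q :: real
  assumes "0 \<le> q" "q \<le> 1" "k \<ge> 1" "e \<le> real k"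
  shows "q ^ k \<le> q powr e"
proof (cases "q = 0")
  case False
  then show ?thesis
    using assms powr_mono'[of e "real k" q] by (simp add: powr_realpow)
qed (use assms in \<open>simp add: power_0_left\<close>)

lemma norm_triangle_squared: "(norm (a - c))\<^sup>2 \<le> 2 * (norm (a - b))\<^sup>2 + 2 * (norm (b - c))\<^sup>2"
  for a b c :: "'a::real_inner"
proof -
  have "norm (a - c) \<le> norm (a - b) + norm (b - c)"
    using norm_triangle_ineq[of "a - b" "b - c"] by simp
  then have "(norm (a - c))\<^sup>2 \<le> (norm (a - b) + norm (b - c))\<^sup>2" by (intro power_mono) auto
  then show ?thesis
    using sum_squares_bound[of "norm (a - b)" "norm (b - c)"] by (simp add: power2_sum)
qed

theorem theorem7:
  fixes f :: "nat \<Rightarrow> real ^ 'n::finite \<Rightarrow> real"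
    and G :: "nat \<Rightarrow> real ^ 'n \<Rightarrow> real ^ 'n"
    and \<Theta> :: "(real ^ 'n) set"
    and blk :: "'n \<Rightarrow> 'p::finite"
    and x xs :: "nat \<Rightarrow> real ^ 'n"
    and \<mu> L \<alpha> Lmax Abar B6 CT2 C2 :: real
    and Lc :: "'p \<Rightarrow> real"
    and k T :: nat
  assumes "\<And>t. convex_on UNIV (f t)"
    and "\<And>t z. GDERIV (f t) z :> G t z"
    and "\<And>t. continuous_on UNIV (G t)"
    and "\<Theta> \<noteq> {}" and "closed \<Theta>" and "convex \<Theta>"
    and "\<And>t. is_arg_min (f t) (\<lambda>z. z \<in> \<Theta>) (xs t)"
    and "\<And>t. G t (xs t) = 0"
    and "\<mu> > 0" and "L > 0" and "\<And>p. Lc p > 0"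
    and "\<And>t z y. f t y \<ge> f t z + G t z \<bullet> (y - z) + \<mu> / 2 * (norm (y - z))\<^sup>2"
    and "\<And>t z y. norm (G t z - G t y) \<le> L * norm (z - y)"
    and "\<And>t z p u. u \<in> block_space blk p \<Longrightarrow>
           norm (block blk p (G t (z + u)) - block blk p (G t z)) \<le> Lc p * norm u"
    and "Lmax = Max (range Lc)"
    and "0 < \<alpha>" and "\<alpha> < 2 / Lmax"
    and "Abar = 1 / real CARD('p) * (\<alpha> - \<alpha>\<^sup>2 * Lmax / 2)"
    and "k \<ge> 1"
    and "B6 = L / \<mu> * (1 - 2 * \<mu> * Abar) powr ((real k + 1 - real CARD('p)) / real CARD('p))
                * (1 + \<alpha> * Lmax) ^ (2 * CARD('p) - 2)"
    and "B6 < 1 / 2"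
    and "online_cd_gauss_southwell \<Theta> blk G (\<lambda>_. \<alpha>) k x"
    and "T \<ge> 1"
    and "CT2 = (\<Sum>t=1..T. (norm (xs t - xs (t - 1)))\<^sup>2)"
    and "C2 = (norm (x 1 - xs 1))\<^sup>2 - 2 * (norm (xs 1 - xs 0))\<^sup>2"
  shows "dynamic_regret f x xs T \<le> L / (2 - 4 * B6) * (2 * CT2 + C2)"
proof -
  note deriv = assms(2) and \<Theta> = assms(4-6) and minimizer = assms(7) and crit = assms(8)
    and sc = assms(12) and glip = assms(13) and blip = assms(14) and Lmax = assms(15)
    and Abar = assms(18) and B6 = assms(20) and alg = assms(22)
  have Lc_le: "Lc p \<le> Lmax" for p unfolding Lmax by (intro Max_ge) auto
  have "Lmax > 0" using Lc_le[of undefined] assms(11)[of undefined] by linarith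
  have lip: "norm (block blk p (G t (z + u)) - block blk p (G t z)) \<le> Lmax * norm u"
    if "u \<in> block_space blk p" for t z p u
    using blip[OF that, of t z] mult_right_mono[OF Lc_le[of p], of "norm u"] by simp
  have "\<alpha> * (\<alpha> * Lmax) < \<alpha> * 2"
    using assms(16,17) \<open>Lmax > 0\<close> by (intro mult_strict_left_mono) (auto simp: field_simps)
  then have step: "0 \<le> \<alpha> - \<alpha>\<^sup>2 * Lmax / 2" by (simp add: power2_eq_square algebra_simps)
  interpret cd: block_smooth_strongly_convex "f t" "G t" blk \<mu> Lmax \<alpha> for t
    using deriv sc assms(9) lip step by unfold_locales
  have gain: "cd.gain = Abar" by (simp add: cd.gain_def Abar)
  define q where "q = 1 - 2 * \<mu> * Abar"
  have q0: "0 \<le> q"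
    using cd.contraction_factor_nonneg[OF crit] by (simp add: gain q_def)
  have q1: "q \<le> 1"
    using cd.gain_nonneg assms(9) by (simp add: gain q_def)

  have rate: "L / \<mu> * q ^ k \<le> B6"
  proof -
    have P: "1 \<le> real CARD('p)" by (simp add: Suc_le_eq)
    have "real k * 1 \<le> real k * real CARD('p)" by (intro mult_left_mono P) auto
    then have "real k + 1 - real CARD('p) \<le> real k * real CARD('p)" using P by linarith
    then have "(real k + 1 - real CARD('p)) / real CARD('p) \<le> real k"
      by (simp add: divide_le_eq)
    then have "q ^ k \<le> q powr ((real k + 1 - real CARD('p)) / real CARD('p))"
      using q0 q1 assms(19) by (intro power_le_powr)
    then have "L / \<mu> * q ^ k \<le> L / \<mu> * q powr ((real k + 1 - real CARD('p)) / real CARD('p))"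
      using assms(9,10) by (intro mult_left_mono) auto
    \<comment> \<open>The last factor of \<open>B6\<close> is at least 1.\<close>
    also have "\<dots> * 1 \<le> \<dots> * (1 + \<alpha> * Lmax) ^ (2 * CARD('p) - 2)"
      using assms(9,10,16) \<open>Lmax > 0\<close> by (intro mult_left_mono one_le_power) auto
    finally show ?thesis by (simp add: B6 q_def)
  qed
  have "0 \<le> L / \<mu> * q ^ k" using assms(9,10) q0 by simp
  with rate have "0 \<le> B6" by linarith

  define d where "d t = (norm (x t - xs t))\<^sup>2" for t
  define e where "e t = 2 * (norm (xs t - xs (t - 1)))\<^sup>2" for t
  have rec: "d (Suc t) \<le> 2 * B6 * d t + e (Suc t)" for t
  proof -
    obtain xh where xh: "xh 0 = x t" "x (Suc t) = closest_point \<Theta> (xh k)"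
      "\<And>\<kappa>. \<kappa> < k \<Longrightarrow> gauss_southwell_update blk (G t) \<alpha> (xh \<kappa>) (xh (Suc \<kappa>))"
      using alg unfolding online_cd_gauss_southwell_def by blast
    have "xs t \<in> \<Theta>" using minimizer[of t] by (simp add: is_arg_min_def)
    then have "norm (x (Suc t) - xs t) \<le> norm (xh k - xs t)"
      using closest_point_lipschitz[OF \<Theta>(3,2,1), of "xh k" "xs t"]
      by (simp add: xh(2) closest_point_self dist_norm)
    then have "(norm (x (Suc t) - xs t))\<^sup>2 \<le> (norm (xh k - xs t))\<^sup>2" by (intro power_mono) auto
    also have "\<dots> \<le> L / \<mu> * q ^ k * d t"
      using cd.gauss_southwell_steps_dist[of t "xs t" L k xh, OF crit glip xh(3)]
      by (simp add: gain q_def d_def xh(1))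
    also have "\<dots> \<le> B6 * d t"
      using rate by (intro mult_right_mono) (auto simp: d_def)
    finally show ?thesis
      using norm_triangle_squared[of "x (Suc t)" "xs (Suc t)" "xs t"]
      by (simp add: d_def e_def norm_minus_commute)
  qed
  have "(1 - 2 * B6) * (\<Sum>t=1..T. d t) \<le> (\<Sum>t=1..T. e t) + d 1 - e 1"
    using rec \<open>0 \<le> B6\<close> assms(23) by (intro sum_le_of_contraction) (auto simp: d_def)
  also have "\<dots> = 2 * CT2 + C2"
    by (simp add: assms(24,25) d_def e_def sum_distrib_left)
  finally have sum_d: "(\<Sum>t=1..T. d t) \<le> (2 * CT2 + C2) / (1 - 2 * B6)"
    using assms(21) by (simp add: field_simps)

  have "f t (x t) - f t (xs t) \<le> L / 2 * d t" for t
    using lipschitz_gradient_upper_bound[of "f t" "G t" L, OF deriv glip, of "xs t" "x t - xs t"]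
    by (simp add: crit d_def)
  then have "dynamic_regret f x xs T \<le> (\<Sum>t=1..T. L / 2 * d t)"
    unfolding dynamic_regret_def sum_subtractf[symmetric] by (intro sum_mono)
  also have "\<dots> \<le> L / 2 * ((2 * CT2 + C2) / (1 - 2 * B6))"
    using sum_d assms(10) by (simp only: sum_distrib_left[symmetric]) (intro mult_left_mono, auto)
  also have "\<dots> = L / (2 - 4 * B6) * (2 * CT2 + C2)"
    using assms(21) by (simp add: field_simps)
  finally show ?thesis .
qed

end
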